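(* The set $\bar{\mathcal C}(F)$ equals the set of all matrices $\begin{pmatrix} 1 & \mathbf x^\top \\ \mathbf x & X \end{pmatrix}$ (with $\mathbf x\in\mathbb R^2$ and $X\in\mathbb R^{2\times2}$ symmetric) such that $$\begin{pmatrix} 1 & \mathbf x^\top \\ \mathbf x & X \end{pmatrix}\succeq0,\qquad \begin{pmatrix} x_1 & X_{12} \\ X_{12} & x_2 \end{pmatrix}\succeq0,$$ and there exist $s_1,s_2\in\mathbb R$ with $$\begin{pmatrix} x_2 & X_{12} \\ X_{12} & s_1 \end{pmatrix}\succeq0,\qquad \begin{pmatrix} X_{11} & s_1 & x_1-s_1 \\ s_1 & X_{12} & 0 \\ x_1-s_1 & 0 & 1-X_{12} \end{pmatrix}\succeq0,$$ $$\begin{pmatrix} x_1 & X_{12} \\ X_{12} & s_2 \end{pmatrix}\succeq0,\qquad \begin{pmatrix} X_{22} & s_2 & x_2-s_2 \\ s_2 & X_{12} & 0 \\ x_2-s_2 & 0 & 1-X_{12} \end{pmatrix}\succeq0.$$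
   Context: Let $F:=\{\mathbf x=(x_1,x_2)\in\mathbb R^2 : x_1\ge 0,\ x_2\ge 0,\ x_1x_2\le 1\}$. The closed lifted convex hull of $F$ is $$\bar{\mathcal C}(F):=\overline{\operatorname{conv}}\left\{\begin{pmatrix} 1 \\ \mathbf x \end{pmatrix}\begin{pmatrix} 1 \\ \mathbf x \end{pmatrix}^{\top} : \mathbf x\in F\right\},$$ the closure of the convex hull, in the space of real symmetric $3\times3$ matrices. $M\succeq0$ means that the symmetric matrix $M$ is positive semidefinite. *)

theory Defs
  imports "HOL-Analysis.Analysis"
begin

definition psd :: "real^'n^'n \<Rightarrow> bool" where
  "psd M \<longleftrightarrow> transpose M = M \<and> (\<forall>v. 0 \<le> v \<bullet> (M *v v))"

definition F :: "(real^2) set" where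
  "F = {x. 0 \<le> x $ 1 \<and> 0 \<le> x $ 2 \<and> x $ 1 * x $ 2 \<le> 1}"

definition lift_vec :: "real^2 \<Rightarrow> real^3" where
  "lift_vec x = vector [1, x $ 1, x $ 2]"

text \<open>
  The closure is taken in the space of all real \<open>3 \<times> 3\<close> matrices. Since the symmetric
  matrices form a closed subspace containing the convex hull, this is the same set as
  the closure in the space of symmetric matrices.
\<close>

definition closed_lifted_hull :: "(real^2) set \<Rightarrow> (real^3^3) set" where
  "closed_lifted_hull S =
     closure (convex hull {(columnvector (lift_vec x) :: real^1^3) ** rowvector (lift_vec x) | x. x \<in> S})"

definition block_mat :: "real^2 \<Rightarrow> real^2^2 \<Rightarrow> real^3^3" where
  "block_mat x X = vector
     [vector [1, x $ 1, x $ 2],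
      vector [x $ 1, X $ 1 $ 1, X $ 1 $ 2],
      vector [x $ 2, X $ 2 $ 1, X $ 2 $ 2]]"

definition mat2 :: "real \<Rightarrow> real \<Rightarrow> real \<Rightarrow> real \<Rightarrow> real^2^2" where
  "mat2 a b c d = vector [vector [a, b], vector [c, d]]"

definition mat3 ::
  "real \<Rightarrow> real \<Rightarrow> real \<Rightarrow> real \<Rightarrow> real \<Rightarrow> real \<Rightarrow> real \<Rightarrow> real \<Rightarrow> real \<Rightarrow> real^3^3" where
  "mat3 a b c d e f g h i = vector [vector [a, b, c], vector [d, e, f], vector [g, h, i]]"

end

theory Submission
  imports Defs
begin

text \<open>
  The right-hand side is closed and convex because the auxiliary variables are bounded by
  \<open>s\<^sub>1\<^sup>2 \<le> X\<^sub>1\<^sub>1 X\<^sub>1\<^sub>2\<close> and \<open>s\<^sub>2\<^sup>2 \<le> X\<^sub>2\<^sub>2 X\<^sub>1\<^sub>2\<close>. Conversely, the hull is closed under increasing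
  \<open>X\<^sub>1\<^sub>1\<close> and \<open>X\<^sub>2\<^sub>2\<close>, as \<open>F\<close> contains both half-axes. So it suffices to realise some covariance matrix
  that agrees with \<open>X - x x\<^sup>T\<close> off the diagonal and is at most as large on it. If the off-diagonal entry
  vanishes, the point mass at \<open>x\<close> does. Otherwise one finds a rank-one matrix \<open>v v\<^sup>T\<close>, the covariance of a
  measure on two points \<open>x - v / r\<close> and \<open>x + r v\<close>. The conditions on \<open>s\<^sub>1\<close> and \<open>s\<^sub>2\<close> say exactly that, for positive
  covariance, \<open>v\<close> and \<open>r\<close> can be chosen with both points in \<open>F\<close>.
\<close>

section \<open>Small semidefinite matrices as quadratic forms\<close>

lemma mat3_nth [simp]:
  "mat3 a b c d e f g h i $ 1 $ 1 = a" "mat3 a b c d e f g h i $ 1 $ 2 = b" "mat3 a b c d e f g h i $ 1 $ 3 = c"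
  "mat3 a b c d e f g h i $ 2 $ 1 = d" "mat3 a b c d e f g h i $ 2 $ 2 = e" "mat3 a b c d e f g h i $ 2 $ 3 = f"
  "mat3 a b c d e f g h i $ 3 $ 1 = g" "mat3 a b c d e f g h i $ 3 $ 2 = h" "mat3 a b c d e f g h i $ 3 $ 3 = i"
  by (simp_all add: mat3_def vector_3)

lemma block_mat_eq_mat3:
  "block_mat x X = mat3 1 (x$1) (x$2) (x$1) (X$1$1) (X$1$2) (x$2) (X$2$1) (X$2$2)"
  by (simp add: block_mat_def mat3_def)

lemma psd_mat2_iff:
  "psd (mat2 a b b d) \<longleftrightarrow> (\<forall>u v. 0 \<le> a*u\<^sup>2 + 2*b*u * v + d * v\<^sup>2)"
proof -
  have form: "w \<bullet> (mat2 a b b d *v w) = a*(w$1)\<^sup>2 + 2*b*(w$1)*(w$2) + d*(w$2)\<^sup>2" for w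
    by (simp add: mat2_def inner_vec_def matrix_vector_mult_def sum_2 vector_2 algebra_simps
        power2_eq_square)
  have "\<exists>w :: real^2. w$1 = u \<and> w$2 = v" for u v
    by (rule exI [of _ "vector [u, v]"]) (simp add: vector_2)
  moreover have "transpose (mat2 a b b d) = mat2 a b b d"
    by (simp add: mat2_def transpose_def vec_eq_iff forall_2 vector_2)
  ultimately show ?thesis
    unfolding psd_def form by metis
qed

lemma psd_mat3_iff:
  "psd (mat3 a b c b e f c f i) \<longleftrightarrow>
    (\<forall>u v w. 0 \<le> a*u\<^sup>2 + e * v\<^sup>2 + i*w\<^sup>2 + 2*b*u * v + 2*c*u*w + 2*f * v * w)"
proof -
  have form: "z \<bullet> (mat3 a b c b e f c f i *v z) =
      a*(z$1)\<^sup>2 + e*(z$2)\<^sup>2 + i*(z$3)\<^sup>2 + 2*b*(z$1)*(z$2) + 2*c*(z$1)*(z$3) + 2*f*(z$2)*(z$3)" for z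
    by (simp add: inner_vec_def matrix_vector_mult_def sum_3 algebra_simps power2_eq_square)
  have "\<exists>z :: real^3. z$1 = u \<and> z$2 = v \<and> z$3 = w" for u v w
    by (rule exI [of _ "vector [u, v, w]"]) (simp add: vector_3)
  moreover have "transpose (mat3 a b c b e f c f i) = mat3 a b c b e f c f i"
    by (simp add: transpose_def vec_eq_iff forall_3)
  ultimately show ?thesis
    unfolding psd_def form by metis
qed

text \<open>If \<open>a = 0\<close>, the form is affine in \<open>u\<close>, which forces
  \<open>b = 0\<close>; otherwise its value at \<open>(b, -a)\<close> is
  \<open>a * (a*c - b\<^sup>2)\<close>.\<close>

lemma nonneg_quadratic_form_discriminant:
  fixes a b c :: real
  assumes form: "\<And>u v. 0 \<le> a*u\<^sup>2 + 2*b*u * v + c * v\<^sup>2"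
  shows "b\<^sup>2 \<le> a * c"
proof (cases "a = 0")
  case True
  have "b = 0"
  proof (rule ccontr)
    assume "b \<noteq> 0"
    \<comment> \<open>At this point the form takes the value \<open>-1\<close>.\<close>
    then show False using form [of "- (c + 1) / (2*b)" 1] True by (simp add: field_simps)
  qed
  then show ?thesis using True by simp
next
  case False
  then have "a > 0" using form [of 1 0] by simp
  moreover have "0 \<le> a * (a*c - b\<^sup>2)"
    using form [of b "-a"] by (simp add: algebra_simps power2_eq_square)
  ultimately show ?thesis by (simp add: zero_le_mult_iff)
qed

lemma psd_mat2D:
  assumes "psd (mat2 a b b d)"
  shows "0 \<le> a" "0 \<le> d" "b\<^sup>2 \<le> a * d"
proof -
  have form: "0 \<le> a*u\<^sup>2 + 2*b*u * v + d * v\<^sup>2" for u v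
    using assms by (simp add: psd_mat2_iff)
  show "0 \<le> a" "0 \<le> d" using form [of 1 0] form [of 0 1] by simp_all
  show "b\<^sup>2 \<le> a * d" by (rule nonneg_quadratic_form_discriminant) (rule form)
qed

section \<open>Closedness and convexity of the semidefinite constraints\<close>

lemma closed_psd: "closed {M :: real^'n^'n. psd M}"
proof -
  have "closed {M :: real^'n^'n. \<forall>i j. M$i$j = M$j$i}"
    by (intro closed_Collect_all closed_Collect_eq continuous_intros)
  moreover have "closed {M :: real^'n^'n. \<forall>v. 0 \<le> v \<bullet> (M *v v)}"
    unfolding inner_vec_def matrix_vector_mult_def
    by (intro closed_Collect_all closed_Collect_le) (auto intro!: continuous_intros)
  moreover have "{M :: real^'n^'n. psd M} =
      {M. \<forall>i j. M$i$j = M$j$i} \<inter> {M. \<forall>v. 0 \<le> v \<bullet> (M *v v)}"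
    by (auto simp: psd_def transpose_def vec_eq_iff)
  ultimately show ?thesis by (simp add: closed_Int)
qed

lemma psd_convex_combination:
  fixes A B :: "real^'n^'n"
  assumes "psd A" "psd B" "0 \<le> u" "0 \<le> v"
  shows "psd (u *\<^sub>R A + v *\<^sub>R B)"
proof -
  have sym: "A$i$j = A$j$i" "B$i$j = B$j$i" for i j
    using assms(1,2) unfolding psd_def transpose_def by (metis vec_lambda_beta)+
  have "w \<bullet> ((u *\<^sub>R A + v *\<^sub>R B) *v w) = u * (w \<bullet> (A *v w)) + v * (w \<bullet> (B *v w))" for w
    by (simp add: matrix_vector_mult_add_rdistrib inner_add_right
        flip: scaleR_matrix_vector_assoc)
  then show ?thesis
    using assms sym unfolding psd_def by (simp add: transpose_def vec_eq_iff)
qed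

lemma closed_psd_mat2:
  fixes f g h :: "'a::t2_space \<Rightarrow> real"
  assumes "continuous_on UNIV f" "continuous_on UNIV g" "continuous_on UNIV h"
  shows "closed {x. psd (mat2 (f x) (g x) (g x) (h x))}"
  unfolding psd_mat2_iff by (intro closed_Collect_all closed_Collect_le continuous_intros assms)

lemma closed_psd_mat3:
  fixes f g h k l m :: "'a::t2_space \<Rightarrow> real"
  assumes "continuous_on UNIV f" "continuous_on UNIV g" "continuous_on UNIV h"
    "continuous_on UNIV k" "continuous_on UNIV l" "continuous_on UNIV m"
  shows "closed {x. psd (mat3 (f x) (g x) (h x) (g x) (k x) (l x) (h x) (l x) (m x))}"
  unfolding psd_mat3_iff by (intro closed_Collect_all closed_Collect_le continuous_intros assms)

text \<open>The constraints are read off the entries of \<open>M\<close>, with \<open>s\<close>,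
  \<open>t\<close> for \<open>s\<^sub>1\<close>, \<open>s\<^sub>2\<close>. They thus cut out a
  subset of a product space, whose projection to \<open>M\<close> is the right-hand side.\<close>

definition feasible :: "real^3^3 \<Rightarrow> real \<Rightarrow> real \<Rightarrow> bool" where
  "feasible M s t \<longleftrightarrow> M$1$1 = 1 \<and> psd M \<and>
    psd (mat2 (M$1$2) (M$2$3) (M$2$3) (M$1$3)) \<and>
    psd (mat2 (M$1$3) (M$2$3) (M$2$3) s) \<and>
    psd (mat3 (M$2$2) s (M$1$2 - s) s (M$2$3) 0 (M$1$2 - s) 0 (1 - M$2$3)) \<and>
    psd (mat2 (M$1$2) (M$2$3) (M$2$3) t) \<and>
    psd (mat3 (M$3$3) t (M$1$3 - t) t (M$2$3) 0 (M$1$3 - t) 0 (1 - M$2$3))"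

lemma closed_feasible: "closed {z. feasible (fst z) (fst (snd z)) (snd (snd z))}"
  unfolding feasible_def
  by (intro closed_Collect_conj closed_Collect_eq closed_psd_mat2 closed_psd_mat3 continuous_intros
      closed_vimage [OF closed_psd, unfolded vimage_def mem_Collect_eq])

lemma convex_feasible: "convex {z. feasible (fst z) (fst (snd z)) (snd (snd z))}"
proof -
  have mat2: "psd (mat2 (u*a+v * a') (u*b+v * b') (u*b+v * b') (u*d+v * d'))"
    if "psd (mat2 a b b d)" "psd (mat2 a' b' b' d')" "0 \<le> u" "0 \<le> v" for a b d a' b' d' u v :: real
  proof -
    have "u *\<^sub>R mat2 a b b d + v *\<^sub>R mat2 a' b' b' d' =
        mat2 (u*a+v * a') (u*b+v * b') (u*b+v * b') (u*d+v * d')"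
      by (simp add: mat2_def vec_eq_iff forall_2 vector_2)
    then show ?thesis using psd_convex_combination [OF that] by simp
  qed
  \<comment> \<open>The corner \<open>1 - p\<close> is affine but not linear, so here the weights
    must sum to one.\<close>
  have mat3: "psd (mat3 (u*a+v * a') (u * s+v * s') (u*x+v * x'-(u * s+v * s')) (u * s+v * s') (u*p+v * p') 0
      (u*x+v * x'-(u * s+v * s')) 0 (1-(u*p+v * p')))"
    if "psd (mat3 a s (x-s) s p 0 (x-s) 0 (1-p))" "psd (mat3 a' s' (x'-s') s' p' 0 (x'-s') 0 (1-p'))"
      "0 \<le> u" "0 \<le> v" "u + v = 1" for a s x p a' s' x' p' u v :: real
  proof -
    have "u *\<^sub>R mat3 a s (x-s) s p 0 (x-s) 0 (1-p) + v *\<^sub>R mat3 a' s' (x'-s') s' p' 0 (x'-s') 0 (1-p') =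
        mat3 (u*a+v * a') (u * s+v * s') (u*x+v * x'-(u * s+v * s')) (u * s+v * s') (u*p+v * p') 0
          (u*x+v * x'-(u * s+v * s')) 0 (1-(u*p+v * p'))"
      using that(5) by (simp add: vec_eq_iff forall_3 algebra_simps)
    then show ?thesis using psd_convex_combination [OF that(1-4)] by simp
  qed
  show ?thesis
    unfolding convex_def feasible_def
    by (auto intro!: mat2 mat3 psd_convex_combination)
qed

text \<open>These are principal minors of the two three-by-three matrices, obtained by putting
  \<open>w = 0\<close> in their forms.\<close>

lemma feasible_bounds:
  assumes "feasible M s t"
  shows "s\<^sup>2 \<le> M$2$2 * M$2$3" "t\<^sup>2 \<le> M$3$3 * M$2$3"
proof -
  have forms: "0 \<le> M$2$2*u\<^sup>2 + M$2$3 * v\<^sup>2 + (1 - M$2$3)*w\<^sup>2 + 2 * s*u * v + 2*(M$1$2-s)*u*w"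
    "0 \<le> M$3$3*u\<^sup>2 + M$2$3 * v\<^sup>2 + (1 - M$2$3)*w\<^sup>2 + 2*t*u * v + 2*(M$1$3-t)*u*w" for u v w
    using assms by (simp_all add: feasible_def psd_mat3_iff)
  show "s\<^sup>2 \<le> M$2$2 * M$2$3" "t\<^sup>2 \<le> M$3$3 * M$2$3"
    by (rule nonneg_quadratic_form_discriminant, use forms(1) [of _ _ 0] forms(2) [of _ _ 0] in \<open>simp add: algebra_simps\<close>)+
qed

text \<open>A projection of a closed set need not be closed. Here the auxiliary variables stay
  bounded along a convergent sequence of matrices, so a subsequence of the triples converges to a
  feasible triple.\<close>

lemma closed_projection_feasible: "closed {M. \<exists>s t. feasible M s t}"
  unfolding closed_sequential_limits
proof (intro allI impI, elim conjE)
  fix M :: "nat \<Rightarrow> real^3^3" and L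
  assume "\<forall>n. M n \<in> {M. \<exists>s t. feasible M s t}" and lim: "M \<longlonglongrightarrow> L"
  then obtain s t where feas: "\<And>n. feasible (M n) (s n) (t n)"
    unfolding mem_Collect_eq choice_iff by blast
  \<comment> \<open>The index \<open>i = 2\<close> serves \<open>s\<close>, and \<open>i = 3\<close>
    serves \<open>t\<close>.\<close>
  have bdd: "bounded (range x)" if "\<And>n. (x n)\<^sup>2 \<le> M n $ i $ i * M n $ 2 $ 3" for x :: "nat \<Rightarrow> real" and i
  proof -
    have "(\<lambda>n. M n $ i $ i * M n $ 2 $ 3) \<longlonglongrightarrow> L $ i $ i * L $ 2 $ 3"
      by (intro tendsto_intros lim)
    then have "Bseq (\<lambda>n. M n $ i $ i * M n $ 2 $ 3)"
      by (intro convergent_imp_Bseq convergentI)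
    then obtain K where K: "0 < K" "\<forall>n. norm (M n $ i $ i * M n $ 2 $ 3) \<le> K"
      by (rule BseqE)
    have "norm (x n) \<le> sqrt K" for n
    proof -
      have "(x n)\<^sup>2 \<le> K" using that [of n] K(2) [rule_format, of n] unfolding real_norm_def by linarith
      then show ?thesis using real_sqrt_le_mono by fastforce
    qed
    then show ?thesis unfolding bounded_iff by blast
  qed
  define z where "z n = (M n, s n, t n)" for n
  have "bounded (range M)" using lim by (simp add: convergent_imp_bounded)
  moreover have "bounded (range s)" "bounded (range t)"
    using bdd feasible_bounds feas by blast+
  ultimately have "bounded (range M \<times> range s \<times> range t)"
    by (intro bounded_Times)
  then have "bounded (range z)"
    by (rule bounded_subset) (auto simp: z_def)
  then obtain l r where r: "strict_mono r" "(z \<circ> r) \<longlonglongrightarrow> l"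
    using bounded_imp_convergent_subsequence by blast
  have "feasible (fst l) (fst (snd l)) (snd (snd l))"
    using closed_sequentially [OF closed_feasible _ r(2)] feas by (simp add: z_def)
  moreover have "(\<lambda>n. fst ((z \<circ> r) n)) \<longlonglongrightarrow> fst l"
    using r(2) by (rule tendsto_fst)
  then have "fst l = L"
    using LIMSEQ_subseq_LIMSEQ [OF lim r(1)] by (auto simp: z_def o_def intro: LIMSEQ_unique)
  ultimately show "L \<in> {M. \<exists>s t. feasible M s t}" by auto
qed

lemma convex_projection_feasible: "convex {M. \<exists>s t. feasible M s t}"
proof -
  have "{M. \<exists>s t. feasible M s t} = fst ` {z. feasible (fst z) (fst (snd z)) (snd (snd z))}"
    by (force simp: image_iff)
  then show ?thesis
    using convex_linear_image [OF linear_fst convex_feasible] by simp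
qed

section \<open>The hull satisfies the constraints\<close>

lemma lifted_point:
  "(columnvector (lift_vec x) :: real^1^3) ** rowvector (lift_vec x) =
    mat3 1 (x$1) (x$2) (x$1) ((x$1)\<^sup>2) (x$1 * x$2) (x$2) (x$1 * x$2) ((x$2)\<^sup>2)"
  by (simp add: vec_eq_iff forall_3 columnvector_def rowvector_def matrix_matrix_mult_def lift_vec_def
      vector_3 power2_eq_square)

text \<open>The witnesses are the third-order moments \<open>x\<^sub>1\<^sup>2 x\<^sub>2\<close> and \<open>x\<^sub>1 x\<^sub>2\<^sup>2\<close>.\<close>

lemma feasible_lifted_point:
  assumes "0 \<le> x" "0 \<le> y" "x * y \<le> 1"
  shows "feasible (mat3 1 x y x (x\<^sup>2) (x * y) y (x * y) (y\<^sup>2)) (x * (x * y)) (y * (x * y))"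
proof -
  \<comment> \<open>Used with \<open>p = x * y\<close> and \<open>c = x\<close> or
    \<open>c = y\<close>: the form is a sum of two squares with weights \<open>p\<close> and
    \<open>1 - p\<close>.\<close>
  have third: "psd (mat3 (c\<^sup>2) (c * p) (c - c * p) (c * p) p 0 (c - c * p) 0 (1 - p))"
    if "0 \<le> p" "p \<le> 1" for c p :: real
    unfolding psd_mat3_iff
  proof (intro allI)
    fix u v w :: real
    have "0 \<le> p * (c*u + v)\<^sup>2 + (1 - p) * (c*u + w)\<^sup>2" using that by simp
    also have "\<dots> = c\<^sup>2*u\<^sup>2 + p * v\<^sup>2 + (1 - p)*w\<^sup>2 + 2*(c * p)*u * v + 2*(c - c * p)*u*w + 2*0 * v * w"
      by algebra
    finally show "0 \<le> \<dots>" .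
  qed
  have "psd (mat3 1 x y x (x\<^sup>2) (x * y) y (x * y) (y\<^sup>2))"
    unfolding psd_mat3_iff
  proof (intro allI)
    fix u v w :: real
    have "0 \<le> (u + x * v + y*w)\<^sup>2" by simp
    also have "\<dots> = 1*u\<^sup>2 + x\<^sup>2 * v\<^sup>2 + y\<^sup>2*w\<^sup>2 + 2*x*u * v + 2*y*u*w + 2*(x * y) * v * w" by algebra
    finally show "0 \<le> \<dots>" .
  qed
  moreover have "psd (mat2 x (x * y) (x * y) y)"
    unfolding psd_mat2_iff
  proof (intro allI)
    fix u v :: real
    have "0 \<le> x * (u + y * v)\<^sup>2 + y * (1 - x * y) * v\<^sup>2" using assms by simp
    also have "\<dots> = x*u\<^sup>2 + 2*(x * y)*u * v + y * v\<^sup>2" by algebra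
    finally show "0 \<le> \<dots>" .
  qed
  moreover have second: "psd (mat2 d (c * d) (c * d) (c * (c * d)))" if "0 \<le> d" for c d
    unfolding psd_mat2_iff
  proof (intro allI)
    fix u v :: real
    have "0 \<le> d * (u + c * v)\<^sup>2" using that by simp
    also have "\<dots> = d*u\<^sup>2 + 2*(c * d)*u * v + (c * (c * d)) * v\<^sup>2" by algebra
    finally show "0 \<le> \<dots>" .
  qed
  moreover have "psd (mat2 x (x * y) (x * y) (y * (x * y)))"
    using second [of x y] assms by (simp add: mult.commute)
  ultimately show ?thesis
    using assms by (simp add: feasible_def third)
qed

lemma closed_lifted_hull_subset: "closed_lifted_hull F \<subseteq> {M. \<exists>s t. feasible M s t}"
  unfolding closed_lifted_hull_def
proof (intro closure_minimal hull_minimal closed_projection_feasible convex_projection_feasible subsetI)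
  fix M assume "M \<in> {(columnvector (lift_vec x) :: real^1^3) ** rowvector (lift_vec x) | x. x \<in> F}"
  then obtain x where "x \<in> F" "M = (columnvector (lift_vec x) :: real^1^3) ** rowvector (lift_vec x)"
    by blast
  then have "feasible M (x$1 * (x$1 * x$2)) (x$2 * (x$1 * x$2))"
    using feasible_lifted_point unfolding lifted_point F_def by blast
  then show "M \<in> {M. \<exists>s t. feasible M s t}" by blast
qed

section \<open>Constructing elements of the hull\<close>

lemma convex_closed_lifted_hull: "convex (closed_lifted_hull S)"
  by (simp add: closed_lifted_hull_def convex_closure)

lemma lifted_point_in_closed_lifted_hull:
  assumes "0 \<le> x" "0 \<le> y" "x * y \<le> 1"
  shows "mat3 1 x y x (x\<^sup>2) (x * y) y (x * y) (y\<^sup>2) \<in> closed_lifted_hull F"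
proof -
  have "vector [x, y] \<in> F" using assms by (simp add: F_def vector_2)
  then have "(columnvector (lift_vec (vector [x, y])) :: real^1^3) ** rowvector (lift_vec (vector [x, y]))
      \<in> closed_lifted_hull F"
    unfolding closed_lifted_hull_def
    by (intro set_mp [OF closure_subset] hull_inc) blast
  then show ?thesis by (simp add: lifted_point vector_2)
qed

text \<open>Mass \<open>1 / (n + 1)\<close> at the point \<open>(\<surd>(n + 1) c, \<surd>(n + 1) d)\<close> contributes only to the second
  moments in the limit.\<close>

lemma closed_lifted_hull_recession:
  assumes M: "M \<in> closed_lifted_hull F" and cd: "0 \<le> c" "0 \<le> d" "c * d = 0"
  shows "M + mat3 0 0 0 0 (c\<^sup>2) 0 0 0 (d\<^sup>2) \<in> closed_lifted_hull F"
proof -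
  define e where "e n = inverse (sqrt (real (Suc n)))" for n
  have e: "e n > 0" "(e n)\<^sup>2 \<le> 1" for n
    by (simp_all add: e_def power_inverse inverse_le_1_iff)
  have "(\<lambda>n. inverse (real (Suc n))) \<longlonglongrightarrow> 0" by (rule LIMSEQ_inverse_real_of_nat)
  then have "(\<lambda>n. sqrt (inverse (real (Suc n)))) \<longlonglongrightarrow> sqrt 0" by (rule tendsto_real_sqrt)
  then have lim: "e \<longlonglongrightarrow> 0" by (simp add: e_def [abs_def] real_sqrt_inverse)
  define N where "N n = (1 - (e n)\<^sup>2) *\<^sub>R M +
      (e n)\<^sup>2 *\<^sub>R mat3 1 (c / e n) (d / e n) (c / e n) ((c / e n)\<^sup>2) (c / e n * (d / e n))
        (d / e n) (c / e n * (d / e n)) ((d / e n)\<^sup>2)" for n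
  have "N n \<in> closed_lifted_hull F" for n
    unfolding N_def using e [of n] cd
    by (intro convexD [OF convex_closed_lifted_hull] M lifted_point_in_closed_lifted_hull) auto
  \<comment> \<open>The weight \<open>(e n)\<^sup>2\<close> cancels the scaling of the second
    moments and leaves a factor \<open>e n\<close> on the first moments; the mixed moment vanishes
    because \<open>c * d = 0\<close>.\<close>
  moreover have N_eq: "N n = (1 - (e n)\<^sup>2) *\<^sub>R M + (mat3 0 0 0 0 (c\<^sup>2) 0 0 0 (d\<^sup>2) +
      (e n)\<^sup>2 *\<^sub>R mat3 1 0 0 0 0 0 0 0 0 + e n *\<^sub>R mat3 0 c d c 0 0 d 0 0)" for n
    unfolding N_def using e [of n] cd(3)
    by (auto simp: vec_eq_iff forall_3 power2_eq_square field_simps)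
  have "N \<longlonglongrightarrow> (1 - 0\<^sup>2) *\<^sub>R M + (mat3 0 0 0 0 (c\<^sup>2) 0 0 0 (d\<^sup>2) +
      0\<^sup>2 *\<^sub>R mat3 1 0 0 0 0 0 0 0 0 + 0 *\<^sub>R mat3 0 c d c 0 0 d 0 0)"
    unfolding N_eq [abs_def] by (intro tendsto_intros lim)
  ultimately show ?thesis
    using closed_sequentially [of "closed_lifted_hull F" N]
    by (simp add: closed_lifted_hull_def)
qed

text \<open>One recession step along each half-axis, since a single step requires
  \<open>c * d = 0\<close>.\<close>

lemma closed_lifted_hull_upward:
  assumes M: "mat3 1 x y x a p y p b \<in> closed_lifted_hull F" and "a \<le> a'" "b \<le> b'"
  shows "mat3 1 x y x a' p y p b' \<in> closed_lifted_hull F"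
proof -
  have "mat3 1 x y x a p y p b + mat3 0 0 0 0 ((sqrt (a'-a))\<^sup>2) 0 0 0 (0\<^sup>2)
      + mat3 0 0 0 0 (0\<^sup>2) 0 0 0 ((sqrt (b'-b))\<^sup>2) \<in> closed_lifted_hull F"
    using assms by (intro closed_lifted_hull_recession) auto
  moreover have "mat3 1 x y x a p y p b + mat3 0 0 0 0 ((sqrt (a'-a))\<^sup>2) 0 0 0 (0\<^sup>2)
      + mat3 0 0 0 0 (0\<^sup>2) 0 0 0 ((sqrt (b'-b))\<^sup>2) = mat3 1 x y x a' p y p b'"
    using assms by (simp add: vec_eq_iff forall_3)
  ultimately show ?thesis by simp
qed

text \<open>The weights \<open>r\<^sup>2 / (1 + r\<^sup>2)\<close> and \<open>1 / (1 + r\<^sup>2)\<close> at the parameters \<open>-1/r\<close> and \<open>r\<close> of the line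
  have mean zero and variance one.\<close>

lemma two_point_in_closed_lifted_hull:
  assumes r: "0 < r"
    and y: "0 \<le> x1 - v1 / r" "0 \<le> x2 - v2 / r" "(x1 - v1 / r) * (x2 - v2 / r) \<le> 1"
    and z: "0 \<le> x1 + r * v1" "0 \<le> x2 + r * v2" "(x1 + r * v1) * (x2 + r * v2) \<le> 1"
  shows "mat3 1 x1 x2 x1 (x1\<^sup>2 + v1\<^sup>2) (x1 * x2 + v1 * v2) x2 (x1 * x2 + v1 * v2) (x2\<^sup>2 + v2\<^sup>2)
    \<in> closed_lifted_hull F"
proof -
  define w where "w = 1 / (1 + r\<^sup>2)"
  have pos: "1 + r\<^sup>2 > 0" by (simp add: add_pos_nonneg)
  have w: "0 \<le> w" "0 \<le> w * r\<^sup>2" "w * r\<^sup>2 + w = 1"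
    using pos by (simp_all add: w_def field_simps)
  have mean: "w * r\<^sup>2 * (c - d / r) + w * (c + r * d) = c" for c d
  proof -
    have "w * r\<^sup>2 * (c - d / r) + w * (c + r * d) = (w * r\<^sup>2 + w) * c"
      using r by (simp add: field_simps power2_eq_square)
    then show ?thesis using w by simp
  qed
  have moment: "w * r\<^sup>2 * ((c - d / r) * (c' - d' / r)) + w * ((c + r * d) * (c' + r * d')) = c * c' + d * d'"
    for c d c' d'
  proof -
    have "w * r\<^sup>2 * ((c - d / r) * (c' - d' / r)) + w * ((c + r * d) * (c' + r * d')) =
        (w * r\<^sup>2 + w) * (c * c' + d * d')"
      using r by (simp add: field_simps power2_eq_square)
    then show ?thesis using w by simp
  qed
  note square = moment [of c d c d for c d, folded power2_eq_square]
  let ?Y = "mat3 1 (x1 - v1 / r) (x2 - v2 / r) (x1 - v1 / r) ((x1 - v1 / r)\<^sup>2)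
    ((x1 - v1 / r) * (x2 - v2 / r)) (x2 - v2 / r) ((x1 - v1 / r) * (x2 - v2 / r)) ((x2 - v2 / r)\<^sup>2)"
  let ?Z = "mat3 1 (x1 + r * v1) (x2 + r * v2) (x1 + r * v1) ((x1 + r * v1)\<^sup>2)
    ((x1 + r * v1) * (x2 + r * v2)) (x2 + r * v2) ((x1 + r * v1) * (x2 + r * v2)) ((x2 + r * v2)\<^sup>2)"
  have "(w * r\<^sup>2) *\<^sub>R ?Y + w *\<^sub>R ?Z \<in> closed_lifted_hull F"
    using w by (intro convexD [OF convex_closed_lifted_hull] lifted_point_in_closed_lifted_hull y z)
  moreover have "(w * r\<^sup>2) *\<^sub>R ?Y + w *\<^sub>R ?Z =
      mat3 1 x1 x2 x1 (x1\<^sup>2 + v1\<^sup>2) (x1 * x2 + v1 * v2) x2 (x1 * x2 + v1 * v2) (x2\<^sup>2 + v2\<^sup>2)"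
    using w(3) by (simp add: vec_eq_iff forall_3 mean moment square)
  ultimately show ?thesis by simp
qed

text \<open>Here the slope of the line is negative, and both points are taken on the hyperbola of
  constant product \<open>p\<close>.\<close>

lemma negative_covariance:
  assumes x: "0 \<le> x1" "0 \<le> x2" and p: "0 \<le> p" "p \<le> 1" "p < x1 * x2"
    and a: "x1\<^sup>2 \<le> a" and ab: "(p - x1 * x2)\<^sup>2 \<le> (a - x1\<^sup>2) * (b - x2\<^sup>2)"
  shows "mat3 1 x1 x2 x1 a p x2 p b \<in> closed_lifted_hull F"
proof -
  define q where "q = x1 * x2 - p"
  have q: "q > 0" using p by (simp add: q_def)
  have prod: "q\<^sup>2 \<le> (a - x1\<^sup>2) * (b - x2\<^sup>2)"
    using ab by (simp add: q_def power2_commute)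
  have "a \<noteq> x1\<^sup>2" using prod q by auto
  with a have a': "0 < a - x1\<^sup>2" by simp
  \<comment> \<open>All the variance available in the first coordinate is spent. Then
    \<open>\<beta>\<close> is forced by the covariance \<open>-q\<close>, and the determinant bound
    makes it fit the second coordinate.\<close>
  define \<alpha> where "\<alpha> = sqrt (a - x1\<^sup>2)"
  define \<beta> where "\<beta> = q / \<alpha>"
  have \<alpha>: "0 < \<alpha>" "\<alpha>\<^sup>2 = a - x1\<^sup>2" using a' by (simp_all add: \<alpha>_def)
  have \<beta>: "0 < \<beta>" "\<alpha> * \<beta> = q" using \<alpha> q by (simp_all add: \<beta>_def)
  have "\<beta>\<^sup>2 = q\<^sup>2 / (a - x1\<^sup>2)" by (simp add: \<beta>_def power_divide \<alpha>(2))
  then have \<beta>2: "\<beta>\<^sup>2 \<le> b - x2\<^sup>2" using prod a' by (simp add: pos_divide_le_eq mult.commute)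
  define k where "k = (\<alpha> * x2 - \<beta> * x1) / q"
  define r where "r = (k + sqrt (k\<^sup>2 + 4)) / 2"
  have "\<bar>k\<bar> < sqrt (k\<^sup>2 + 4)" by (rule real_less_rsqrt) simp
  then have r: "0 < r" by (simp add: r_def)
  have "(sqrt (k\<^sup>2 + 4))\<^sup>2 = k\<^sup>2 + 4" by simp
  then have quad: "r\<^sup>2 = k * r + 1" by (simp add: r_def power2_eq_square field_simps)
  have kq: "k * q = \<alpha> * x2 - \<beta> * x1" using q by (simp add: k_def)
  have "(x1 + r * \<alpha>) * (x2 - r * \<beta>) = x1 * x2 + r * (k * q) - r\<^sup>2 * q"
    unfolding kq unfolding \<beta>(2) [symmetric] by algebra
  then have z: "(x1 + r * \<alpha>) * (x2 - r * \<beta>) = p"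
    by (simp add: quad q_def algebra_simps)
  have "(x1 - \<alpha> / r) * (x2 + \<beta> / r) * r\<^sup>2 = x1 * x2 * r\<^sup>2 - r * (k * q) - q"
    unfolding kq unfolding \<beta>(2) [symmetric] using r by (simp add: field_simps power2_eq_square)
  also have "\<dots> = p * r\<^sup>2" by (simp add: quad q_def algebra_simps)
  finally have y: "(x1 - \<alpha> / r) * (x2 + \<beta> / r) = p" using r by simp
  have pos: "0 < x1 + r * \<alpha>" "0 < x2 + \<beta> / r"
    using r x \<alpha> \<beta> by (simp_all add: add_nonneg_pos)
  \<comment> \<open>In each product, which equals \<open>p\<close> and so is nonnegative, one factor
    is already known to be positive.\<close>
  have "0 \<le> x2 - r * \<beta>" "0 \<le> x1 - \<alpha> / r"
    using z y pos p(1) by (metis zero_le_mult_iff less_le_not_le order.trans)+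
  then have "mat3 1 x1 x2 x1 (x1\<^sup>2 + \<alpha>\<^sup>2) (x1 * x2 + \<alpha> * (-\<beta>)) x2 (x1 * x2 + \<alpha> * (-\<beta>)) (x2\<^sup>2 + (-\<beta>)\<^sup>2)
      \<in> closed_lifted_hull F"
    using r y z pos p by (intro two_point_in_closed_lifted_hull [of r]) auto
  then have "mat3 1 x1 x2 x1 (x1\<^sup>2 + \<alpha>\<^sup>2) p x2 p (x2\<^sup>2 + \<beta>\<^sup>2) \<in> closed_lifted_hull F"
    by (simp add: \<beta>(2) q_def)
  then show ?thesis
    by (rule closed_lifted_hull_upward) (use \<alpha>(2) \<beta>2 in simp_all)
qed

text \<open>Here the slope of the line is positive. The lower point gets weight \<open>1 - p\<close> and the upper one
  weight \<open>p\<close>; since the mean product is \<open>p\<close>, the product at the upper point is at most \<open>1\<close>.\<close>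

lemma positive_covariance:
  assumes x: "0 \<le> x1" "0 \<le> x2" and p: "0 \<le> p" "x1 * x2 < p" "p\<^sup>2 \<le> x1 * x2"
    and a: "x1\<^sup>2 \<le> a" and ab: "(p - x1 * x2)\<^sup>2 \<le> (a - x1\<^sup>2) * (b - x2\<^sup>2)"
    and bounds: "p * (p - x1 * x2)\<^sup>2 \<le> (1 - p) * x2\<^sup>2 * (a - x1\<^sup>2)"
      "p * (p - x1 * x2)\<^sup>2 \<le> (1 - p) * x1\<^sup>2 * (b - x2\<^sup>2)"
  shows "mat3 1 x1 x2 x1 a p x2 p b \<in> closed_lifted_hull F"
proof -
  define q where "q = p - x1 * x2"
  have q: "0 < q" using p by (simp add: q_def)
  have "0 < p" using p mult_nonneg_nonneg [OF x] by linarith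
  then have "0 < x1 * x2" using p(3) by (smt (verit) zero_less_power)
  then have x_pos: "0 < x1" "0 < x2" using x by (auto simp: zero_less_mult_iff)
  have "p * p < p * 1" using p(2,3) by (simp add: power2_eq_square)
  then have p1: "p < 1" using \<open>0 < p\<close> by simp
  have "a \<noteq> x1\<^sup>2" using ab q by (auto simp: q_def)
  with a have a': "0 < a - x1\<^sup>2" by simp
  \<comment> \<open>This value makes \<open>1 / (1 + r\<^sup>2)\<close> equal to
    \<open>p\<close>.\<close>
  define r where "r = sqrt ((1 - p) / p)"
  have r: "0 < r" "r\<^sup>2 = (1 - p) / p" using \<open>0 < p\<close> p1 by (simp_all add: r_def)
  \<comment> \<open>The largest value allowed by the variance and by
    \<open>0 \<le> x1 - \<alpha> / r\<close>, which makes \<open>\<beta>\<close> as small as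
    possible.\<close>
  define \<alpha> where "\<alpha> = min (sqrt (a - x1\<^sup>2)) (x1 * r)"
  define \<beta> where "\<beta> = q / \<alpha>"
  have \<alpha>: "0 < \<alpha>" "\<alpha> \<le> x1 * r" using a' x_pos r by (simp_all add: \<alpha>_def)
  have \<alpha>_cases: "\<alpha>\<^sup>2 = a - x1\<^sup>2 \<or> \<alpha>\<^sup>2 = x1\<^sup>2 * r\<^sup>2"
    using a' by (auto simp: \<alpha>_def min_def power_mult_distrib)
  have \<beta>: "0 < \<beta>" "\<alpha> * \<beta> = q" using \<alpha> q by (simp_all add: \<beta>_def)
  have "\<alpha>\<^sup>2 \<le> (sqrt (a - x1\<^sup>2))\<^sup>2" using \<alpha>(1) by (intro power_mono) (simp_all add: \<alpha>_def)
  then have \<alpha>2: "\<alpha>\<^sup>2 \<le> a - x1\<^sup>2" using a' by simp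
  \<comment> \<open>Each upper bound on \<open>\<beta>\<close> needs one inequality per candidate in
    the minimum. The variance bound uses \<open>ab\<close> and \<open>bounds(2)\<close>; the bound
    for the lower point uses \<open>bounds(1)\<close> and
    \<open>p\<^sup>2 \<le> x1 * x2\<close>.\<close>
  have \<beta>2: "\<beta>\<^sup>2 \<le> c" if "q\<^sup>2 \<le> (a - x1\<^sup>2) * c" "q\<^sup>2 \<le> x1\<^sup>2 * r\<^sup>2 * c" for c
  proof -
    have "q\<^sup>2 \<le> \<alpha>\<^sup>2 * c" using that \<alpha>_cases by auto
    then show ?thesis using \<alpha>(1) by (simp add: \<beta>_def power_divide field_simps)
  qed
  have "\<beta>\<^sup>2 \<le> b - x2\<^sup>2"
    using ab bounds(2) \<open>0 < p\<close> by (intro \<beta>2) (simp_all add: q_def r(2) field_simps)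
  have "q \<le> x1 * x2 * r\<^sup>2"
    unfolding r(2) using p \<open>0 < p\<close> by (simp add: q_def field_simps power2_eq_square)
  then have "q\<^sup>2 \<le> (x1 * x2 * r\<^sup>2)\<^sup>2" using q by (intro power_mono) auto
  then have "q\<^sup>2 \<le> x1\<^sup>2 * r\<^sup>2 * (x2 * r)\<^sup>2" by (simp add: power2_eq_square mult_ac)
  moreover have "q\<^sup>2 \<le> (a - x1\<^sup>2) * (x2 * r)\<^sup>2"
    unfolding power_mult_distrib r(2) using bounds(1) \<open>0 < p\<close> by (simp add: q_def field_simps)
  ultimately have "\<beta>\<^sup>2 \<le> (x2 * r)\<^sup>2" by (intro \<beta>2)
  then have \<beta>_le: "\<beta> \<le> x2 * r" by (rule power2_le_imp_le) (use x_pos r(1) in simp)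
  have y: "0 \<le> x1 - \<alpha> / r" "0 \<le> x2 - \<beta> / r"
    using \<alpha>(2) \<beta>_le r(1) by (simp_all add: field_simps)
  have le: "x1 - \<alpha> / r \<le> x1 + r * \<alpha>" "x2 - \<beta> / r \<le> x2 + r * \<beta>"
  proof -
    have "0 \<le> \<alpha> / r" "0 \<le> r * \<alpha>" "0 \<le> \<beta> / r" "0 \<le> r * \<beta>"
      using \<alpha>(1) \<beta>(1) r(1) by simp_all
    then show "x1 - \<alpha> / r \<le> x1 + r * \<alpha>" "x2 - \<beta> / r \<le> x2 + r * \<beta>" by linarith+
  qed
  have "p * ((x1 + r * \<alpha>) * (x2 + r * \<beta>)) =
      p - (1 - p) * ((x1 - \<alpha> / r) * (x2 - \<beta> / r))"
  proof -
    have inv: "1 - p = p * r\<^sup>2" using r(2) \<open>0 < p\<close> by simp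
    have "p * r\<^sup>2 * ((x1 - \<alpha> / r) * (x2 - \<beta> / r)) = p * ((r * x1 - \<alpha>) * (r * x2 - \<beta>))"
      using r(1) by (simp add: field_simps power2_eq_square)
    also have "p * ((x1 + r * \<alpha>) * (x2 + r * \<beta>)) + \<dots> = (p * r\<^sup>2 + p) * (x1 * x2 + \<alpha> * \<beta>)"
      by algebra
    also have "\<dots> = p" using inv by (simp add: \<beta>(2) q_def)
    finally show ?thesis unfolding inv by simp
  qed
  also have "\<dots> \<le> p" using y p1 by simp
  finally have z: "(x1 + r * \<alpha>) * (x2 + r * \<beta>) \<le> 1" using \<open>0 < p\<close> by simp
  \<comment> \<open>The lower point is dominated coordinatewise by the upper one.\<close>
  have "(x1 - \<alpha> / r) * (x2 - \<beta> / r) \<le> 1"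
    using mult_mono [OF le] y le z by linarith
  then have "mat3 1 x1 x2 x1 (x1\<^sup>2 + \<alpha>\<^sup>2) (x1 * x2 + \<alpha> * \<beta>) x2 (x1 * x2 + \<alpha> * \<beta>) (x2\<^sup>2 + \<beta>\<^sup>2)
      \<in> closed_lifted_hull F"
    using r y z le by (intro two_point_in_closed_lifted_hull [of r]) auto
  then have "mat3 1 x1 x2 x1 (x1\<^sup>2 + \<alpha>\<^sup>2) p x2 p (x2\<^sup>2 + \<beta>\<^sup>2) \<in> closed_lifted_hull F"
    by (simp add: \<beta>(2) q_def)
  then show ?thesis
    by (rule closed_lifted_hull_upward) (use \<alpha>2 \<open>\<beta>\<^sup>2 \<le> b - x2\<^sup>2\<close> in simp_all)
qed

section \<open>Every feasible matrix lies in the hull\<close>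

text \<open>Eliminates \<open>s\<close>: the Schur complement bounds the distance of
  \<open>s\<close> from \<open>p*x\<close> above, while \<open>p\<^sup>2 \<le> y * s\<close> bounds
  it below.\<close>

lemma second_moment_bound:
  assumes M: "psd (mat3 a s (x - s) s p 0 (x - s) 0 (1 - p))" and s: "psd (mat2 y p p s)"
    and p: "0 < p" "p < 1" "x * y < p" and y: "0 \<le> y"
  shows "p * (p - x * y)\<^sup>2 \<le> (1 - p) * y\<^sup>2 * (a - x\<^sup>2)"
proof -
  \<comment> \<open>For the given \<open>u = p*(1-p)\<close>, these \<open>v\<close> and
    \<open>w\<close> minimise the form.\<close>
  have "0 \<le> a*(p*(1-p))\<^sup>2 + p*(-s*(1-p))\<^sup>2 + (1-p)*(-(x-s)*p)\<^sup>2
      + 2 * s*(p*(1-p))*(-s*(1-p)) + 2*(x-s)*(p*(1-p))*(-(x-s)*p) + 2*0*(-s*(1-p))*(-(x-s)*p)"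
    using M unfolding psd_mat3_iff by blast
  also have "\<dots> = (p*(1-p)) * ((a - x\<^sup>2)*(p*(1-p)) - (s - p*x)\<^sup>2)" by algebra
  finally have "0 \<le> (p*(1-p)) * ((a - x\<^sup>2)*(p*(1-p)) - (s - p*x)\<^sup>2)" .
  moreover have "0 < p*(1-p)" using p by simp
  ultimately have "(s - p*x)\<^sup>2 \<le> (a - x\<^sup>2)*(p*(1-p))"
    unfolding zero_le_mult_iff [of "p*(1-p)"] by linarith
  then have "(s - p*x)\<^sup>2 * y\<^sup>2 \<le> (a - x\<^sup>2)*(p*(1-p)) * y\<^sup>2" by (rule mult_right_mono) simp
  \<comment> \<open>From \<open>p\<^sup>2 \<le> y * s\<close> follows
    \<open>p*(p - x*y) \<le> (s - p*x) * y\<close>, whose left side is positive and may be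
    squared.\<close>
  moreover have "(p*(p - x*y))\<^sup>2 \<le> (s - p*x)\<^sup>2 * y\<^sup>2"
    unfolding power_mult_distrib [symmetric, of "s - p*x"]
    using psd_mat2D(3) [OF s] p
    by (intro power_mono) (simp_all add: algebra_simps power2_eq_square)
  ultimately have "p * (p * (p - x*y)\<^sup>2) \<le> p * ((1 - p) * y\<^sup>2 * (a - x\<^sup>2))"
    by (simp add: power2_eq_square mult_ac)
  then show ?thesis using p(1) by simp
qed

lemma feasible_in_closed_lifted_hull:
  assumes "feasible (mat3 1 x1 x2 x1 a p x2 p b) s t"
  shows "mat3 1 x1 x2 x1 a p x2 p b \<in> closed_lifted_hull F"
proof -
  have feas: "psd (mat3 1 x1 x2 x1 a p x2 p b)" "psd (mat2 x1 p p x2)"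
    "psd (mat2 x2 p p s)" "psd (mat3 a s (x1 - s) s p 0 (x1 - s) 0 (1 - p))"
    "psd (mat2 x1 p p t)" "psd (mat3 b t (x2 - t) t p 0 (x2 - t) 0 (1 - p))"
    using assms by (simp_all add: feasible_def)
  have x: "0 \<le> x1" "0 \<le> x2" "p\<^sup>2 \<le> x1 * x2" using psd_mat2D [OF feas(2)] by auto
  have form3: "0 \<le> a*u\<^sup>2 + p * v\<^sup>2 + (1 - p)*w\<^sup>2 + 2 * s*u * v + 2*(x1 - s)*u*w" for u v w
    using feas(4) by (simp add: psd_mat3_iff)
  have p: "0 \<le> p" "p \<le> 1" using form3 [of 0 1 0] form3 [of 0 0 1] by simp_all
  \<comment> \<open>Minimising over the first coordinate of the test vector leaves the form of the
    covariance matrix.\<close>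
  have cov: "0 \<le> (a - x1\<^sup>2)*u\<^sup>2 + 2*(p - x1*x2)*u * v + (b - x2\<^sup>2) * v\<^sup>2" for u v
  proof -
    have "0 \<le> 1*(-x1*u - x2 * v)\<^sup>2 + a*u\<^sup>2 + b * v\<^sup>2 + 2*x1*(-x1*u - x2 * v)*u
        + 2*x2*(-x1*u - x2 * v) * v + 2*p*u * v"
      using feas(1) unfolding psd_mat3_iff by blast
    also have "\<dots> = (a - x1\<^sup>2)*u\<^sup>2 + 2*(p - x1*x2)*u * v + (b - x2\<^sup>2) * v\<^sup>2" by algebra
    finally show ?thesis .
  qed
  have a: "x1\<^sup>2 \<le> a" and b: "x2\<^sup>2 \<le> b" using cov [of 1 0] cov [of 0 1] by simp_all
  have ab: "(p - x1 * x2)\<^sup>2 \<le> (a - x1\<^sup>2) * (b - x2\<^sup>2)"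
    by (rule nonneg_quadratic_form_discriminant) (rule cov)
  consider "p = x1 * x2" | "p < x1 * x2" | "x1 * x2 < p" by linarith
  then show ?thesis
  proof cases
    case 1
    then show ?thesis
      using lifted_point_in_closed_lifted_hull [of x1 x2] x p a b
      by (auto intro: closed_lifted_hull_upward)
  next
    case 2
    then show ?thesis using negative_covariance x p a ab by blast
  next
    case 3
    have "0 < p" using 3 mult_nonneg_nonneg [OF x(1,2)] by linarith
    have "p * p < p * 1" using 3 x(3) by (simp add: power2_eq_square)
    then have "p < 1" using \<open>0 < p\<close> by simp
    show ?thesis
    proof (rule positive_covariance [OF x(1,2) p(1) 3 x(3) a ab])
      show "p * (p - x1 * x2)\<^sup>2 \<le> (1 - p) * x2\<^sup>2 * (a - x1\<^sup>2)"
        using second_moment_bound [OF feas(4,3) \<open>0 < p\<close> \<open>p < 1\<close> 3 x(2)] .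
      show "p * (p - x1 * x2)\<^sup>2 \<le> (1 - p) * x1\<^sup>2 * (b - x2\<^sup>2)"
        \<comment> \<open>The same bound with the two coordinates exchanged.\<close>
        using second_moment_bound [OF feas(6,5) \<open>0 < p\<close> \<open>p < 1\<close> _ x(1)] 3 by (simp add: mult.commute)
    qed
  qed
qed

section \<open>Translation into block matrices\<close>

lemma psd_eq_block_mat:
  assumes "psd M" "M$1$1 = 1"
  obtains x X where "transpose X = X" "M = block_mat x X"
proof
  have sym: "M$i$j = M$j$i" for i j
    using assms(1) by (simp add: psd_def transpose_def vec_eq_iff)
  show "transpose (mat2 (M$2$2) (M$2$3) (M$2$3) (M$3$3)) = mat2 (M$2$2) (M$2$3) (M$2$3) (M$3$3)"
    by (simp add: mat2_def transpose_def vec_eq_iff forall_2 vector_2)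
  show "M = block_mat (vector [M$1$2, M$1$3]) (mat2 (M$2$2) (M$2$3) (M$2$3) (M$3$3))"
    using assms(2) sym [of 2 1] sym [of 3 1] sym [of 3 2]
    by (simp add: block_mat_eq_mat3 mat2_def vec_eq_iff forall_3 vector_2)
qed

lemma feasible_block_mat:
  "feasible (block_mat x X) s t \<longleftrightarrow> psd (block_mat x X) \<and>
    psd (mat2 (x$1) (X$1$2) (X$1$2) (x$2)) \<and>
    psd (mat2 (x$2) (X$1$2) (X$1$2) s) \<and>
    psd (mat3 (X$1$1) s (x$1 - s) s (X$1$2) 0 (x$1 - s) 0 (1 - X$1$2)) \<and>
    psd (mat2 (x$1) (X$1$2) (X$1$2) t) \<and>
    psd (mat3 (X$2$2) t (x$2 - t) t (X$1$2) 0 (x$2 - t) 0 (1 - X$1$2))"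
  by (simp add: feasible_def block_mat_eq_mat3)

lemma closed_lifted_hull_eq:
  "closed_lifted_hull F = {block_mat x X | x X. transpose X = X \<and> (\<exists>s t. feasible (block_mat x X) s t)}"
proof (intro equalityI subsetI)
  fix M assume "M \<in> closed_lifted_hull F"
  then obtain s t where "feasible M s t" using closed_lifted_hull_subset by blast
  moreover from this obtain x X where "transpose X = X" "M = block_mat x X"
    by (metis feasible_def psd_eq_block_mat)
  ultimately show "M \<in> {block_mat x X | x X. transpose X = X \<and> (\<exists>s t. feasible (block_mat x X) s t)}"
    by blast
next
  fix M assume "M \<in> {block_mat x X | x X. transpose X = X \<and> (\<exists>s t. feasible (block_mat x X) s t)}"
  then obtain x X s t where X: "transpose X = X" and M: "M = block_mat x X" "feasible M s t" by blast
  have "X$2$1 = X$1$2" using X by (simp add: transpose_def vec_eq_iff)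
  then have "M = mat3 1 (x$1) (x$2) (x$1) (X$1$1) (X$1$2) (x$2) (X$1$2) (X$2$2)"
    using M(1) by (simp add: block_mat_eq_mat3)
  then show "M \<in> closed_lifted_hull F"
    using M(2) feasible_in_closed_lifted_hull by simp
qed

theorem theorem2p4:
  shows "closed_lifted_hull F =
    {block_mat x X | (x :: real^2) (X :: real^2^2).
       transpose X = X \<and>
       psd (block_mat x X) \<and>
       psd (mat2 (x $ 1) (X $ 1 $ 2)
                 (X $ 1 $ 2) (x $ 2)) \<and>
       (\<exists>s1 s2 :: real.
          psd (mat2 (x $ 2) (X $ 1 $ 2)
                    (X $ 1 $ 2) s1) \<and>
          psd (mat3 (X $ 1 $ 1) s1 (x $ 1 - s1)
                    s1 (X $ 1 $ 2) 0
                    (x $ 1 - s1) 0 (1 - X $ 1 $ 2)) \<and>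
          psd (mat2 (x $ 1) (X $ 1 $ 2)
                    (X $ 1 $ 2) s2) \<and>
          psd (mat3 (X $ 2 $ 2) s2 (x $ 2 - s2)
                    s2 (X $ 1 $ 2) 0
                    (x $ 2 - s2) 0 (1 - X $ 1 $ 2)))}"
  unfolding closed_lifted_hull_eq feasible_block_mat by blast

end
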